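(* Let $\alpha$ be a real number with $0<\alpha<1$. There exists an integer $N$ such that for every integer $l$ there exists an infinite binary sequence $\omega$ with the following property: for every finite set $X\subset\mathbb{N}$ with $\#X\ge N$ there exists $t\in X$ such that $$K(X,\omega(X)\mid t,l)\ge \alpha\,\#X .$$
   Context: $K(u\mid v)$ denotes conditional Kolmogorov complexity of a finite object $u$ given a finite object $v$ (finite sets of naturals, strings, integers and tuples of them are encoded as binary strings in a fixed computable way). For an infinite sequence $\omega$ and a finite set $X\subset\mathbb{N}$, $\omega(X)$ denotes the string of length $\#X$ formed by the letters $\omega_i$ with $i\in X$, in increasing order of $i$. Note that $\omega$ may depend on $l$ but $N$ does not. *)

theory Defs
  imports "HOL-Library.Nat_Bijection" "HOL-Library.Extended_Real"
begin

section \<open>Partial recursive functions\<close>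

datatype recf =
    Zero
  | Succ
  | Proj nat
  | Comp recf "recf list"
  | Prim recf recf
  | Mu recf

text \<open>
  \<open>computes f xs y\<close>: the evaluation of \<open>f\<close> on the arguments \<open>xs\<close> halts with value \<open>y\<close>.
  The recursion argument of \<open>Prim\<close> and the search argument of \<open>Mu\<close> come first; \<open>Mu\<close> requires
  all earlier values to be defined and nonzero.  Arities are not enforced by the syntax: a program
  computes a (possibly nowhere defined) partial function of every arity.
\<close>

inductive computes :: "recf \<Rightarrow> nat list \<Rightarrow> nat \<Rightarrow> bool" where
  zero: "computes Zero xs 0"
| succ: "computes Succ [x] (Suc x)"
| proj: "i < length xs \<Longrightarrow> computes (Proj i) xs (xs ! i)"
| comp: "list_all2 (\<lambda>g y. computes g xs y) gs ys \<Longrightarrow> computes f ys z \<Longrightarrow> computes (Comp f gs) xs z"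
| prim_0: "computes f xs y \<Longrightarrow> computes (Prim f g) (0 # xs) y"
| prim_Suc: "computes (Prim f g) (n # xs) r \<Longrightarrow> computes g (n # r # xs) y
    \<Longrightarrow> computes (Prim f g) (Suc n # xs) y"
| mu: "computes f (n # xs) 0 \<Longrightarrow> \<forall>m<n. \<exists>y. computes f (m # xs) (Suc y)
    \<Longrightarrow> computes (Mu f) xs n"

inductive_cases computes_ZeroE: "computes Zero xs y"
inductive_cases computes_SuccE: "computes Succ xs y"
inductive_cases computes_ProjE: "computes (Proj i) xs y"
inductive_cases computes_CompE: "computes (Comp f gs) xs y"
inductive_cases computes_Prim_0E: "computes (Prim f g) (0 # xs) y"
inductive_cases computes_Prim_SucE: "computes (Prim f g) (Suc n # xs) y"
inductive_cases computes_MuE: "computes (Mu f) xs y"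

lemma computes_deterministic:
  "computes f xs y \<Longrightarrow> computes f xs z \<Longrightarrow> y = z"
proof (induction arbitrary: z rule: computes.induct)
  case (comp xs gs ys f y)
  from comp.prems obtain ys' where ys': "list_all2 (\<lambda>g y. computes g xs y) gs ys'"
    "computes f ys' z" by (rule computes_CompE) blast
  have "ys = ys'"
    using comp.IH(1) ys'(1) by (auto simp: list_all2_conv_all_nth intro: nth_equalityI)
  with comp.IH(2) ys'(2) show ?case by blast
next
  case (mu f n xs)
  from mu.prems have z: "computes f (z # xs) 0" "\<forall>m<z. \<exists>y. computes f (m # xs) (Suc y)"
    by (auto elim: computes_MuE)
  show ?case
    using mu.IH z by (metis Zero_not_Suc linorder_neqE_nat)
qed (blast elim: computes_ZeroE computes_SuccE computes_ProjE computes_Prim_0E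
      computes_Prim_SucE)+


section \<open>Encodings by binary strings\<close>

text \<open>
  Bijective base-2 numeration, least significant digit first: \<open>False\<close> and \<open>True\<close> stand for the
  digits 1 and 2.  It identifies binary strings with natural numbers.
\<close>

fun nat_of_string :: "bool list \<Rightarrow> nat" where
  "nat_of_string [] = 0"
| "nat_of_string (b # bs) = 2 * nat_of_string bs + (if b then 2 else 1)"

definition string_of_nat :: "nat \<Rightarrow> bool list" where
  "string_of_nat = inv nat_of_string"

lemma bij_nat_of_string: "bij nat_of_string"
proof (rule bijI)
  show "inj nat_of_string"
  proof (rule injI)
    fix xs ys :: "bool list"
    show "nat_of_string xs = nat_of_string ys \<Longrightarrow> xs = ys"
    proof (induction xs arbitrary: ys)
      case Nil
      then show ?case by (cases ys) (auto split: if_splits)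
    next
      case (Cons b bs)
      then obtain c cs where ys: "ys = c # cs"
        by (cases ys) (auto split: if_splits)
      have "b = c \<and> nat_of_string bs = nat_of_string cs"
        using Cons.prems unfolding ys by (simp split: if_splits; presburger)
      then show ?case using Cons.IH ys by blast
    qed
  qed
next
  have "\<exists>bs. nat_of_string bs = n" for n
  proof (induction n rule: less_induct)
    case (less n)
    consider "n = 0" | m where "n = 2 * m + 1" | m where "n = 2 * m + 2"
      by (metis One_nat_def Suc_eq_plus1 add_2_eq_Suc' evenE mult_0_right mult_Suc_right
          nat.exhaust oddE add.commute)
    then show ?case
    proof cases
      case 1
      then show ?thesis by (intro exI[of _ "[]"]) simp
    next
      case (2 m)
      then obtain bs where "nat_of_string bs = m" using less[of m] by auto
      then show ?thesis using 2 by (intro exI[of _ "False # bs"]) simp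
    next
      case (3 m)
      then obtain bs where "nat_of_string bs = m" using less[of m] by auto
      then show ?thesis using 3 by (intro exI[of _ "True # bs"]) simp
    qed
  qed
  then show "surj nat_of_string" by (metis surjI)
qed

text \<open>
  \<open>set_encode X\<close> is the sum of the powers \<open>2 ^ i\<close> with \<open>i \<in> X\<close>, hence injective on finite sets only.
\<close>

definition encode_set_string :: "nat set \<Rightarrow> bool list \<Rightarrow> bool list" where
  "encode_set_string X s = string_of_nat (prod_encode (set_encode X, nat_of_string s))"

definition encode_nat_int :: "nat \<Rightarrow> int \<Rightarrow> bool list" where
  "encode_nat_int t l = string_of_nat (prod_encode (t, int_encode l))"


section \<open>Conditional Kolmogorov complexity\<close>

text \<open>
  A decompressor maps a description \<open>p\<close> and a condition \<open>v\<close> to an object; \<open>None\<close> means divergence.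
\<close>

definition decompressor :: "(bool list \<Rightarrow> bool list \<Rightarrow> bool list option) \<Rightarrow> bool" where
  "decompressor D \<longleftrightarrow>
     (\<exists>f. \<forall>p v u. D p v = Some u \<longleftrightarrow>
        computes f [nat_of_string p, nat_of_string v] (nat_of_string u))"

text \<open>The value is \<open>\<infinity>\<close> if \<open>u\<close> has no description.\<close>

definition cond_complexity ::
    "(bool list \<Rightarrow> bool list \<Rightarrow> bool list option) \<Rightarrow> bool list \<Rightarrow> bool list \<Rightarrow> enat" where
  "cond_complexity D u v = (INF p\<in>{p. D p v = Some u}. enat (length p))"

text \<open>
  Kolmogorov complexity \<open>K(u | v)\<close> (in the plain version) is \<open>cond_complexity U u v\<close> for an
  arbitrary optimal decompressor \<open>U\<close>.
\<close>

definition optimal_decompressor :: "(bool list \<Rightarrow> bool list \<Rightarrow> bool list option) \<Rightarrow> bool" where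
  "optimal_decompressor U \<longleftrightarrow> decompressor U \<and>
     (\<forall>D. decompressor D \<longrightarrow>
        (\<exists>c::nat. \<forall>u v. cond_complexity U u v \<le> cond_complexity D u v + enat c))"

lemma optimal_decompressor_upper_bound:
  assumes "optimal_decompressor U"
  shows "\<exists>c. \<forall>u v. cond_complexity U u v \<le> enat (length u + c)"
proof -
  have "computes (Proj 0) [x, y] z \<longleftrightarrow> z = x" for x y z
    using proj[of 0 "[x, y]"] by (auto elim: computes_ProjE)
  then have "decompressor (\<lambda>p v. Some p)"
    unfolding decompressor_def
    by (intro exI[of _ "Proj 0"]) (auto dest: injD[OF bij_is_inj[OF bij_nat_of_string]])
  with assms obtain c where
    c: "cond_complexity U u v \<le> cond_complexity (\<lambda>p v. Some p) u v + enat c" for u v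
    unfolding optimal_decompressor_def by blast
  have "cond_complexity (\<lambda>p v. Some p) u v = enat (length u)" for u v
    by (simp add: cond_complexity_def)
  with c show ?thesis by (metis plus_enat_simps(1))
qed


section \<open>Restriction of a sequence to a finite set\<close>

definition restr :: "(nat \<Rightarrow> bool) \<Rightarrow> nat set \<Rightarrow> bool list" where
  "restr \<omega> X = map \<omega> (sorted_list_of_set X)"

end

theory Submission imports Defs begin

(*
  Fewer than 2 ^ (a n + 1) objects have a description shorter than a n under a given condition, so
  each t lies in at most that many pairs (X, s) with #X = n that violate the bound for all t in X.
  It remains to find a sequence avoiding all these pairs.  By Rosenfeld's counting argument (a
  substitute for the Lovasz local lemma) each new position multiplies the number of admissible
  assignments by at least b, for a fixed b with 2 ^ a < b < 2; compactness yields the sequence.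
*)

section \<open>Avoiding sparse families of patterns\<close>

text \<open>
  An assignment of bits to \<open>V\<close> is the set \<open>A \<subseteq> V\<close> of the positions carrying a 1; a pair \<open>(X, B)\<close>
  in \<open>F\<close> forbids that the restriction to \<open>X\<close> equals \<open>B\<close>.
\<close>

definition avoiding :: "('a set \<times> 'a set) set \<Rightarrow> 'a set \<Rightarrow> 'a set set" where
  "avoiding F V = {A. A \<subseteq> V \<and> (\<forall>(X, B)\<in>F. X \<subseteq> V \<longrightarrow> A \<inter> X \<noteq> B)}"

lemma finite_avoiding: "finite V \<Longrightarrow> finite (avoiding F V)"
  by (rule finite_subset[of _ "Pow V"]) (auto simp: avoiding_def)

lemma avoiding_Int: "A \<in> avoiding F V \<Longrightarrow> W \<subseteq> V \<Longrightarrow> A \<inter> W \<in> avoiding F W"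
  unfolding avoiding_def by (fastforce simp: Int_assoc inf.absorb2)

section \<open>Growth of the number of admissible assignments\<close>

text \<open>The positions of \<open>W - U\<close> are added one at a time, each contributing a
  factor \<open>\<beta>\<close>. One-step growth is a premise so that an induction hypothesis can
  take its place in \<open>card_avoiding_growth\<close>.\<close>

lemma card_avoiding_subset_growth:
  fixes \<beta> :: real
  assumes "finite W" "U \<subseteq> W" "0 \<le> \<beta>"
    and "\<And>V v. V \<subseteq> W \<Longrightarrow> v \<in> V \<Longrightarrow>
      \<beta> * card (avoiding F (V - {v})) \<le> card (avoiding F V)"
  shows "\<beta> ^ card (W - U) * card (avoiding F U) \<le> card (avoiding F W)"
proof -
  have "\<beta> ^ card D * card (avoiding F U) \<le> card (avoiding F (U \<union> D))"
    if "finite D" "D \<subseteq> W - U" for D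
    using that
  proof (induction D rule: finite_induct)
    case empty
    then show ?case by simp
  next
    case (insert x D)
    have "\<beta> ^ card (insert x D) * card (avoiding F U)
        = \<beta> * (\<beta> ^ card D * card (avoiding F U))"
      using insert by simp
    also have "\<dots> \<le> \<beta> * card (avoiding F (U \<union> D))"
      using insert assms(3) by (intro mult_left_mono) auto
    also have "U \<union> D = (U \<union> insert x D) - {x}"
      using insert by auto
    also have "\<beta> * card (avoiding F ((U \<union> insert x D) - {x})) \<le> card (avoiding F (U \<union> insert x D))"
      using insert assms(2) by (intro assms(4)) auto
    finally show ?case .
  qed
  from this[of "W - U"] assms(1,2) show ?thesis
    by (simp add: Un_absorb1)
qed

text \<open>An admissible assignment of \<open>V - {v}\<close> extends to \<open>V\<close> in two
  ways. An extension fails only by matching a pair with \<open>v \<in> X\<close>, and is then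
  determined by its bits off \<open>X\<close>. By induction, at most a fraction
  \<open>\<beta> / \<beta> ^ card X\<close>, that is \<open>\<beta>\<close> to the power
  \<open>1 - card X\<close>, of the number of admissible assignments of \<open>V - {v}\<close> is
  lost to one pair; \<open>weight\<close> bounds the total loss by
  \<open>2 - \<beta>\<close>.\<close>

lemma card_avoiding_growth:
  fixes \<beta> :: real
  assumes "finite V" "v \<in> V" "0 < \<beta>"
    and weight: "\<And>V v. finite V \<Longrightarrow> v \<in> V \<Longrightarrow>
      (\<Sum>(X, B)\<in>{(X, B)\<in>F. v \<in> X \<and> X \<subseteq> V \<and> B \<subseteq> X}. \<beta> / \<beta> ^ card X) \<le> 2 - \<beta>"
  shows "\<beta> * card (avoiding F (V - {v})) \<le> card (avoiding F V)"
  using assms(1,2)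
proof (induction "card V" arbitrary: V v rule: less_induct)
  case less
  let ?W = "V - {v}"
  \<comment> \<open>\<open>C\<close> holds the pairs that an extension in \<open>ext\<close> may
    newly match. The condition \<open>B \<subseteq> X\<close> discards pairs that can never be
    matched and makes \<open>C\<close> finite.\<close>
  define C where "C = {(X, B)\<in>F. v \<in> X \<and> X \<subseteq> V \<and> B \<subseteq> X}"
  define ext where "ext = avoiding F ?W \<union> insert v ` avoiding F ?W"
  define viol where "viol c = {A \<in> ext. A \<inter> fst c = snd c}" for c
  have fin_C: "finite C"
    by (rule finite_subset[of _ "Pow V \<times> Pow V"]) (use less.prems in \<open>auto simp: C_def\<close>)
  have fin_W: "finite (avoiding F ?W)"
    using less.prems by (simp add: finite_avoiding)
  then have fin_ext: "finite ext"
    by (simp add: ext_def)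
  have notin: "v \<notin> A" if "A \<in> avoiding F ?W" for A
    using that by (auto simp: avoiding_def)
  then have "inj_on (insert v) (avoiding F ?W)"
    by (intro inj_onI) (metis insert_ident)
  then have "card (insert v ` avoiding F ?W) = card (avoiding F ?W)"
    by (rule card_image)
  moreover have "avoiding F ?W \<inter> insert v ` avoiding F ?W = {}"
    using notin by auto
  ultimately have card_ext: "card ext = 2 * card (avoiding F ?W)"
    unfolding ext_def using fin_W by (subst card_Un_disjoint) auto
  have ext_Int: "A \<inter> ?W \<in> avoiding F ?W" "A \<subseteq> V" if "A \<in> ext" for A
    using that less.prems unfolding ext_def
    by (auto simp: avoiding_def Int_insert_left inf.absorb1 subset_iff Int_absorb2 dest!: Int_absorb2)
  have ext_sub: "ext \<subseteq> avoiding F V \<union> (\<Union>c\<in>C. viol c)"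
  proof
    fix A assume A: "A \<in> ext"
    show "A \<in> avoiding F V \<union> (\<Union>c\<in>C. viol c)"
    proof (cases "A \<in> avoiding F V")
      case False
      then obtain X B where XB: "(X, B) \<in> F" "X \<subseteq> V" "A \<inter> X = B"
        using ext_Int(2)[OF A] by (auto simp: avoiding_def)
      \<comment> \<open>A pair inside \<open>V - {v}\<close> would already be matched by the
        admissible assignment that \<open>A\<close> extends.\<close>
      have "v \<in> X"
      proof (rule ccontr)
        assume "v \<notin> X"
        then have "X \<subseteq> ?W" "A \<inter> ?W \<inter> X = B" using XB by auto
        then show False using ext_Int(1)[OF A] XB(1) by (auto simp: avoiding_def)
      qed
      then have "(X, B) \<in> C" "A \<in> viol (X, B)"
        using XB A by (auto simp: C_def viol_def)
      then show ?thesis by blast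
    qed simp
  qed
  have viol_bound: "card (viol c) \<le> (\<beta> / \<beta> ^ card (fst c)) * card (avoiding F ?W)"
    if "c \<in> C" for c
  proof -
    obtain X B where c: "c = (X, B)" by force
    have X: "v \<in> X" "X \<subseteq> V" using that by (auto simp: C_def c)
    have finX: "finite X" using X less.prems finite_subset by blast
    \<comment> \<open>On \<open>X\<close> every violating assignment equals \<open>B\<close>, so
      only the bits off \<open>X\<close> distinguish two of them.\<close>
    have "inj_on (\<lambda>A. A \<inter> (V - X)) (viol c)"
    proof (rule inj_onI)
      fix A A' assume *: "A \<in> viol c" "A' \<in> viol c" "A \<inter> (V - X) = A' \<inter> (V - X)"
      then have "A \<inter> X = A' \<inter> X" "A \<subseteq> V" "A' \<subseteq> V"
        using ext_Int(2) by (auto simp: viol_def c)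
      with *(3) show "A = A'" by blast
    qed
    moreover have "(\<lambda>A. A \<inter> (V - X)) ` viol c \<subseteq> avoiding F (V - X)"
    proof safe
      fix A assume "A \<in> viol c"
      then have "A \<inter> ?W \<inter> (V - X) \<in> avoiding F (V - X)"
        using X by (intro avoiding_Int[OF ext_Int(1)]) (auto simp: viol_def)
      moreover have "A \<inter> ?W \<inter> (V - X) = A \<inter> (V - X)" using X by auto
      ultimately show "A \<inter> (V - X) \<in> avoiding F (V - X)" by simp
    qed
    ultimately have "card (viol c) \<le> card (avoiding F (V - X))"
      using less.prems by (intro card_inj_on_le) (auto intro: finite_avoiding)
    \<comment> \<open>Passing from \<open>V - X\<close> to \<open>V - {v}\<close> adds the positions
      of \<open>X\<close> other than \<open>v\<close>. All sets involved are smaller than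
      \<open>V\<close>, so the induction hypothesis gives each factor.\<close>
    moreover have "\<beta> ^ card (?W - (V - X)) * card (avoiding F (V - X)) \<le> card (avoiding F ?W)"
    proof (rule card_avoiding_subset_growth)
      fix V' v' assume "V' \<subseteq> ?W" "v' \<in> V'"
      then show "\<beta> * card (avoiding F (V' - {v'})) \<le> card (avoiding F V')"
        using less.prems by (intro less.hyps psubset_card_mono) (auto intro: finite_subset)
    qed (use less.prems X \<open>0 < \<beta>\<close> in auto)
    moreover have "?W - (V - X) = X - {v}" using X by auto
    moreover have "\<beta> ^ card X = \<beta> * \<beta> ^ card (X - {v})"
      using X finX by (metis card_Suc_Diff1 power_Suc)
    ultimately have "\<beta> ^ card (X - {v}) * card (viol c) \<le> card (avoiding F ?W)"
      using \<open>0 < \<beta>\<close> by (smt (verit) mult_left_mono of_nat_mono zero_le_power)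
    then show ?thesis
      using \<open>0 < \<beta>\<close> \<open>\<beta> ^ card X = _\<close> by (simp add: c field_simps)
  qed
  have "2 * real (card (avoiding F ?W)) = card ext"
    by (simp add: card_ext)
  also have "\<dots> \<le> card (avoiding F V \<union> (\<Union>c\<in>C. viol c))"
    using fin_C fin_ext less.prems
    by (intro of_nat_mono card_mono[OF _ ext_sub]) (auto simp: viol_def intro: finite_avoiding)
  also have "\<dots> \<le> card (avoiding F V) + (\<Sum>c\<in>C. card (viol c))"
    using card_Un_le[of "avoiding F V" "\<Union>c\<in>C. viol c"] card_UN_le[OF fin_C, of viol]
    by linarith
  also have "\<dots> \<le> card (avoiding F V) + (\<Sum>c\<in>C. \<beta> / \<beta> ^ card (fst c) * card (avoiding F ?W))"
    using viol_bound by (simp add: sum_mono)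
  also have "\<dots> = card (avoiding F V) + (\<Sum>(X, B)\<in>C. \<beta> / \<beta> ^ card X) * card (avoiding F ?W)"
    by (simp add: sum_distrib_right case_prod_beta)
  also have "\<dots> \<le> card (avoiding F V) + (2 - \<beta>) * card (avoiding F ?W)"
    using weight[OF less.prems] by (simp add: C_def mult_right_mono)
  finally show ?case by (simp add: algebra_simps)
qed

section \<open>From finite segments to an infinite sequence\<close>

text \<open>Koenig's lemma on the binary tree: \<open>f\<close> follows a branch of prefixes, each
  shared by infinitely many of the chosen \<open>A k\<close>. Since every \<open>X\<close> is
  finite, each constraint is decided by some prefix.\<close>

lemma avoiding_compactness:
  fixes F :: "(nat set \<times> nat set) set"
  assumes ne: "\<And>n. avoiding F {..<n} \<noteq> {}" and fin: "\<And>X B. (X, B) \<in> F \<Longrightarrow> finite X"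
  shows "avoiding F UNIV \<noteq> {}"
proof -
  have "\<exists>A. \<forall>n. A n \<in> avoiding F {..<n}"
    using ne by (intro choice) blast
  then obtain A where A: "A n \<in> avoiding F {..<n}" for n by blast
  define P where "P n S \<longleftrightarrow> (\<exists>\<^sub>\<infinity>k. A k \<inter> {..<n} = S)" for n S
  have "\<exists>f. \<forall>n. P n (f n) \<and> f (Suc n) \<inter> {..<n} = f n"
  proof (rule dependent_nat_choice)
    show "\<exists>S. P 0 S" by (auto simp: P_def)
  next
    fix S n assume "P n S"
    \<comment> \<open>Pigeonhole: position \<open>n\<close> carries 0 or 1, and one of these two
      extensions of \<open>S\<close> must recur infinitely often.\<close>
    then have "\<exists>\<^sub>\<infinity>k. A k \<inter> {..<Suc n} = S \<or> A k \<inter> {..<Suc n} = insert n S"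
      unfolding P_def
      by (rule INFM_mono) (auto simp: lessThan_Suc)
    moreover have "S \<subseteq> {..<n}"
      using \<open>P n S\<close> by (auto simp: P_def dest: INFM_EX)
    ultimately show "\<exists>S'. P (Suc n) S' \<and> S' \<inter> {..<n} = S"
      unfolding P_def INFM_disj_distrib by (auto simp: Int_absorb2)
  qed
  then obtain f where f: "P n (f n)" "f (Suc n) \<inter> {..<n} = f n" for n by blast
  have mono: "f m \<inter> {..<n} = f n" if "n \<le> m" for m n
    using that
  proof (induction m rule: dec_induct)
    case base
    show ?case using f(1)[of n] by (auto simp: P_def dest: INFM_EX)
  next
    case (step m)
    have "f (Suc m) \<inter> {..<n} = (f (Suc m) \<inter> {..<m}) \<inter> {..<n}"
      using step.hyps(1) by auto
    then show ?case by (simp only: f(2) step.IH)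
  qed
  define \<Omega> where "\<Omega> = (\<Union>n. f n)"
  have \<Omega>: "\<Omega> \<inter> {..<n} = f n" for n
  proof (rule set_eqI)
    fix x
    have "x \<in> f n" if "x \<in> f m" "x < n" for m
      using that mono[of n m] mono[of m n] by (cases "n \<le> m") auto
    then show "x \<in> \<Omega> \<inter> {..<n} \<longleftrightarrow> x \<in> f n"
      using mono[of n n] by (auto simp: \<Omega>_def)
  qed
  have "\<Omega> \<inter> X \<noteq> B" if XB: "(X, B) \<in> F" for X B
  proof -
    obtain n where n: "X \<subseteq> {..<n}"
      using fin[OF XB] finite_nat_bounded by blast
    \<comment> \<open>The bound \<open>k \<ge> n\<close> ensures
      \<open>X \<subseteq> {..<k}\<close>, so that \<open>A k\<close> is indeed required to avoid
      the pair.\<close>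
    obtain k where k: "k \<ge> n" "A k \<inter> {..<n} = f n"
      using f(1)[of n] unfolding P_def INFM_nat_le by blast
    have "A k \<inter> X \<noteq> B"
      using A[of k] XB k(1) n by (fastforce simp: avoiding_def)
    moreover have "A k \<inter> X = \<Omega> \<inter> X"
      using n k(2) \<Omega>[of n] by blast
    ultimately show ?thesis by simp
  qed
  then show ?thesis by (auto simp: avoiding_def)
qed

lemma avoiding_UNIV_nonempty:
  fixes F :: "(nat set \<times> nat set) set" and \<beta> :: real
  assumes "0 < \<beta>"
    and "\<And>V v. finite V \<Longrightarrow> v \<in> V \<Longrightarrow>
      (\<Sum>(X, B)\<in>{(X, B)\<in>F. v \<in> X \<and> X \<subseteq> V \<and> B \<subseteq> X}. \<beta> / \<beta> ^ card X) \<le> 2 - \<beta>"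
    and "\<And>X B. (X, B) \<in> F \<Longrightarrow> finite X \<and> X \<noteq> {}"
  shows "avoiding F UNIV \<noteq> {}"
proof (rule avoiding_compactness)
  fix n
  have "\<beta> ^ card ({..<n} - {}) * card (avoiding F {}) \<le> card (avoiding F {..<n})"
    using assms(1)
    by (intro card_avoiding_subset_growth card_avoiding_growth assms(2))
       (auto intro: finite_subset)
  \<comment> \<open>The only pairs that could constrain the empty domain have \<open>X = {}\<close>,
    which is excluded; this starts the growth at 1.\<close>
  moreover have "avoiding F {} = {{}}"
    using assms(3) by (fastforce simp: avoiding_def)
  ultimately have "0 < card (avoiding F {..<n})"
    using assms(1) by (smt (verit) card.empty card_insert_disjoint empty_iff finite.emptyI
        mult_pos_pos of_nat_0_less_iff zero_less_Suc zero_less_power)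
  then show "avoiding F {..<n} \<noteq> {}" by auto
qed (use assms(3) in blast)

section \<open>Weights of pairs grouped by size\<close>

text \<open>The pairs with \<open>card X = m\<close> contribute at most
  \<open>K * \<beta> * q ^ m\<close>, since the powers of \<open>\<beta>\<close> cancel; what
  remains is a geometric tail starting at \<open>N\<close>.\<close>

lemma sum_weight_le:
  fixes q \<beta> K :: real
  assumes "finite C" "0 < \<beta>" "0 < q" "q < 1" "0 \<le> K"
    and large: "\<And>X B. (X, B) \<in> C \<Longrightarrow> N \<le> card X"
    and count: "\<And>m. card {(X, B)\<in>C. card X = m} \<le> K * (q * \<beta>) ^ m"
  shows "(\<Sum>(X, B)\<in>C. \<beta> / \<beta> ^ card X) \<le> K * \<beta> * q ^ N / (1 - q)"
proof -
  \<comment> \<open>Inserting \<open>N\<close> keeps the maximum meaningful for empty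
    \<open>C\<close> and guarantees \<open>N \<le> M\<close> for the geometric sum.\<close>
  define M where "M = Max (insert N ((\<lambda>(X, B). card X) ` C))"
  have range: "(\<lambda>(X, B). card X) ` C \<subseteq> {N..M}"
    using assms(1) large by (force simp: M_def intro: Max_ge)
  have "(\<Sum>(X, B)\<in>C. \<beta> / \<beta> ^ card X)
      = (\<Sum>m\<in>{N..M}. \<Sum>c\<in>{c\<in>C. (\<lambda>(X, B). card X) c = m}. (\<lambda>(X, B). \<beta> / \<beta> ^ card X) c)"
    by (rule sum.group[OF assms(1) _ range, symmetric]) simp
  also have "\<dots> = (\<Sum>m\<in>{N..M}. card {(X, B)\<in>C. card X = m} * (\<beta> / \<beta> ^ m))"
  proof (rule sum.cong[OF refl])
    fix m
    have "(\<Sum>c\<in>{c\<in>C. (\<lambda>(X, B). card X) c = m}. (\<lambda>(X, B). \<beta> / \<beta> ^ card X) c)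
        = (\<Sum>c\<in>{(X, B)\<in>C. card X = m}. \<beta> / \<beta> ^ m)"
      by (rule sum.cong) auto
    then show "(\<Sum>c\<in>{c\<in>C. (\<lambda>(X, B). card X) c = m}. (\<lambda>(X, B). \<beta> / \<beta> ^ card X) c)
        = card {(X, B)\<in>C. card X = m} * (\<beta> / \<beta> ^ m)" by simp
  qed
  also have "\<dots> \<le> (\<Sum>m\<in>{N..M}. K * (q * \<beta>) ^ m * (\<beta> / \<beta> ^ m))"
    using assms(2) by (intro sum_mono mult_right_mono count) auto
  also have "\<dots> = K * \<beta> * (\<Sum>m\<in>{N..M}. q ^ m)"
    using assms(2) by (simp add: sum_distrib_left power_mult_distrib field_simps)
  also have "(\<Sum>m\<in>{N..M}. q ^ m) \<le> q ^ N / (1 - q)"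
    using assms(3,4) by (auto simp: sum_gp divide_right_mono)
  finally show ?thesis
    using assms(2,5) by (simp add: mult_left_mono)
qed

section \<open>Counting objects of small complexity\<close>

lemma cond_complexity_less_imp:
  assumes "ereal_of_enat (cond_complexity U u v) < ereal r"
  obtains p where "U p v = Some u" "real (length p) < r"
proof -
  obtain k where k: "cond_complexity U u v = enat k" "real k < r"
    using assms by (cases "cond_complexity U u v") auto
  \<comment> \<open>A strict bound on the infimum yields a description below that bound, hence the
    step to \<open>Suc k\<close>.\<close>
  then have "cond_complexity U u v < enat (Suc k)" by simp
  then obtain p where "U p v = Some u" "length p < Suc k"
    unfolding cond_complexity_def by (auto simp: INF_less_iff)
  with k that show thesis by force
qed

lemma card_short_strings_le:
  fixes r :: real
  assumes "0 \<le> r"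
  shows "finite {p :: bool list. length p < r}" "card {p :: bool list. length p < r} \<le> 2 * 2 powr r"
proof -
  define k where "k = nat \<lfloor>r\<rfloor>"
  have k: "real k \<le> r" using assms by (simp add: k_def)
  have fin: "finite {p :: bool list. set p \<subseteq> UNIV \<and> length p \<le> k}"
    by (rule finite_lists_length_le) simp
  have sub: "{p :: bool list. length p < r} \<subseteq> {p. set p \<subseteq> UNIV \<and> length p \<le> k}"
    by (auto simp: k_def le_nat_floor)
  show "finite {p :: bool list. length p < r}" using fin sub finite_subset by blast
  have "card {p :: bool list. length p < r} \<le> (\<Sum>i\<le>k. 2 ^ i)"
    using card_mono[OF fin sub] card_lists_length_le[of "UNIV :: bool set" k] by simp
  also have "\<dots> \<le> 2 ^ Suc k"
    by (induction k) auto
  finally have "real (card {p :: bool list. length p < r}) \<le> 2 ^ Suc k"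
    by (metis of_nat_le_iff of_nat_numeral of_nat_power)
  also have "\<dots> = 2 * 2 powr k" by (simp add: powr_realpow)
  also have "\<dots> \<le> 2 * 2 powr r" using k by simp
  finally show "card {p :: bool list. length p < r} \<le> 2 * 2 powr r" .
qed

text \<open>Under a fixed condition a description yields at most one object, so choosing a short
  description for each object is injective.\<close>

lemma card_small_complexity_le:
  fixes r :: real
  assumes "0 \<le> r" and inj: "inj_on g S"
    and small: "\<And>c. c \<in> S \<Longrightarrow> ereal_of_enat (cond_complexity U (g c) v) < ereal r"
  shows "card S \<le> 2 * 2 powr r"
proof -
  have "\<exists>p. U p v = Some (g c) \<and> real (length p) < r" if "c \<in> S" for c
    using small[OF that] cond_complexity_less_imp by metis
  then obtain h where h: "U (h c) v = Some (g c)" "real (length (h c)) < r" if "c \<in> S" for c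
    by metis
  have "inj_on h S"
    using inj h(1) by (metis inj_on_def option.inject)
  then have "card S \<le> card {p :: bool list. length p < r}"
    using h(2) by (intro card_inj_on_le card_short_strings_le assms) auto
  then show ?thesis using card_short_strings_le(2)[OF assms(1)] by linarith
qed

lemma restr_cong: "finite X \<Longrightarrow> (\<And>i. i \<in> X \<Longrightarrow> \<omega> i = \<omega>' i) \<Longrightarrow> restr \<omega> X = restr \<omega>' X"
  by (simp add: restr_def)

text \<open>Lets pairs be counted through their encodings. Finiteness makes
  \<open>set_encode\<close> injective, and \<open>B \<subseteq> X\<close> makes \<open>B\<close>
  recoverable from its bits on \<open>X\<close>.\<close>

lemma inj_on_encode_restr:
  "inj_on (\<lambda>(X, B). encode_set_string X (restr (\<lambda>i. i \<in> B) X)) {(X, B). finite X \<and> B \<subseteq> X}"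
proof (rule inj_onI, clarify)
  fix X B X' B' :: "nat set"
  assume fin: "finite X" "finite X'" and sub: "B \<subseteq> X" "B' \<subseteq> X'"
    and eq: "encode_set_string X (restr (\<lambda>i. i \<in> B) X) = encode_set_string X' (restr (\<lambda>i. i \<in> B') X')"
  have "inj string_of_nat"
    unfolding string_of_nat_def by (intro bij_is_inj bij_imp_bij_inv bij_nat_of_string)
  with eq have "set_encode X = set_encode X'"
      "nat_of_string (restr (\<lambda>i. i \<in> B) X) = nat_of_string (restr (\<lambda>i. i \<in> B') X')"
    by (auto simp: encode_set_string_def inj_eq)
  then have X: "X = X'" and "restr (\<lambda>i. i \<in> B) X = restr (\<lambda>i. i \<in> B') X'"
    using fin by (auto simp: set_encode_eq inj_eq[OF bij_is_inj[OF bij_nat_of_string]])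
  then have "\<forall>i\<in>X. i \<in> B \<longleftrightarrow> i \<in> B'"
    using fin by (simp add: restr_def)
  with X sub show "X = X' \<and> B = B'" by blast
qed

section \<open>Choice of the constants and conclusion\<close>

theorem theorem4:
  fixes U :: "bool list \<Rightarrow> bool list \<Rightarrow> bool list option" and \<alpha> :: real
  assumes "optimal_decompressor U" and "0 < \<alpha>" and "\<alpha> < 1"
  shows "\<exists>N::int. \<forall>l::int. \<exists>\<omega>::nat \<Rightarrow> bool. \<forall>X::nat set.
    finite X \<and> N \<le> int (card X) \<longrightarrow>
      (\<exists>t\<in>X. ereal (\<alpha> * real (card X))
        \<le> ereal_of_enat (cond_complexity U (encode_set_string X (restr \<omega> X)) (encode_nat_int t l)))"
proof -
  \<comment> \<open>The exponent is the midpoint of \<alpha> and 1, so \<open>\<beta>\<close> lies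
    strictly between \<open>2 powr \<alpha>\<close> and 2; \<open>q\<close> is the ratio of
    \<open>2 powr \<alpha>\<close> to \<open>\<beta>\<close>.\<close>
  define \<beta> :: real where "\<beta> = 2 powr ((\<alpha> + 1) / 2)"
  define q :: real where "q = 2 powr ((\<alpha> - 1) / 2)"
  have \<beta>: "0 < \<beta>" "\<beta> < 2"
    using \<open>\<alpha> < 1\<close> powr_less_mono[of "(\<alpha> + 1) / 2" 1 2] by (auto simp: \<beta>_def)
  have q: "0 < q" "q < 1"
    using \<open>\<alpha> < 1\<close> powr_less_mono[of "(\<alpha> - 1) / 2" 0 2] by (auto simp: q_def)
  have q\<beta>: "q * \<beta> = 2 powr \<alpha>"
    by (simp add: q_def \<beta>_def flip: powr_add) (simp add: field_simps)
  have "(\<lambda>N. 2 * \<beta> * q ^ N / (1 - q)) \<longlonglongrightarrow> 2 * \<beta> * 0 / (1 - q)"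
    using q by (intro tendsto_intros LIMSEQ_realpow_zero) auto
  then have "eventually (\<lambda>N. 2 * \<beta> * q ^ N / (1 - q) < 2 - \<beta>) sequentially"
    using \<beta> by (intro order_tendstoD(2)) auto
  \<comment> \<open>\<open>N\<close> depends on \<alpha> alone and is fixed before \<open>l\<close>;
    \<open>1 \<le> N\<close> keeps the empty set out of \<open>F\<close>.\<close>
  then obtain N where N: "2 * \<beta> * q ^ N / (1 - q) < 2 - \<beta>" "1 \<le> N"
    using eventually_happens[OF eventually_conj[OF _ eventually_ge_at_top[of 1]]]
    by force
  show ?thesis
  proof (intro exI[of _ "int N"] allI)
    fix l :: int
    define K where "K t X \<omega> = ereal_of_enat
      (cond_complexity U (encode_set_string X (restr \<omega> X)) (encode_nat_int t l))" for t X \<omega>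
    \<comment> \<open>Badness is required for every \<open>t \<in> X\<close>, so a bad pair through
      any given position \<open>v\<close> is simple relative to that \<open>v\<close>.\<close>
    define F where "F = {(X, B). finite X \<and> N \<le> card X \<and> B \<subseteq> X \<and>
      (\<forall>t\<in>X. K t X (\<lambda>i. i \<in> B) < ereal (\<alpha> * card X))}"
    have "avoiding F UNIV \<noteq> {}"
    proof (rule avoiding_UNIV_nonempty[OF \<beta>(1)])
      fix V v assume V: "finite (V :: nat set)" "v \<in> V"
      let ?C = "{(X, B)\<in>F. v \<in> X \<and> X \<subseteq> V \<and> B \<subseteq> X}"
      have "card {(X, B)\<in>?C. card X = m} \<le> 2 * (q * \<beta>) ^ m" for m
      proof -
        \<comment> \<open>All these pairs contain \<open>v\<close>, so the single condition
          \<open>(v, l)\<close> serves for counting them, with the same bound for every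
          \<open>l\<close>.\<close>
        have "real (card {(X, B)\<in>?C. card X = m}) \<le> 2 * 2 powr (\<alpha> * m)"
        proof (rule card_small_complexity_le[where U = U and v = "encode_nat_int v l"])
          show "inj_on (\<lambda>(X, B). encode_set_string X (restr (\<lambda>i. i \<in> B) X))
              {(X, B)\<in>?C. card X = m}"
            by (rule inj_on_subset[OF inj_on_encode_restr]) (auto simp: F_def)
        qed (use \<open>0 < \<alpha>\<close> in \<open>auto simp: F_def K_def\<close>)
        also have "2 powr (\<alpha> * m) = (q * \<beta>) ^ m"
          by (simp add: q\<beta> powr_powr flip: powr_realpow)
        finally show ?thesis .
      qed
      moreover have "finite ?C"
        by (rule finite_subset[of _ "Pow V \<times> Pow V"]) (use V in auto)
      ultimately have "(\<Sum>(X, B)\<in>?C. \<beta> / \<beta> ^ card X) \<le> 2 * \<beta> * q ^ N / (1 - q)"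
        using \<beta> q by (intro sum_weight_le) (auto simp: F_def)
      then show "(\<Sum>(X, B)\<in>?C. \<beta> / \<beta> ^ card X) \<le> 2 - \<beta>"
        using N(1) by linarith
    qed (use N(2) in \<open>auto simp: F_def\<close>)
    then obtain A where A: "A \<inter> X \<noteq> B" if "(X, B) \<in> F" for X B
      by (auto simp: avoiding_def)
    have "\<exists>t\<in>X. ereal (\<alpha> * card X) \<le> K t X (\<lambda>i. i \<in> A)" if X: "finite X" "N \<le> card X" for X
    proof (rule ccontr)
      \<comment> \<open>If every \<open>t \<in> X\<close> failed, the restriction of
        \<open>A\<close> to \<open>X\<close> would itself be a forbidden pattern.\<close>
      assume "\<not> ?thesis"
      moreover have "restr (\<lambda>i. i \<in> A \<inter> X) X = restr (\<lambda>i. i \<in> A) X"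
        using X by (intro restr_cong) auto
      ultimately have "(X, A \<inter> X) \<in> F"
        using X by (auto simp: F_def K_def not_le)
      with A show False by blast
    qed
    then show "\<exists>\<omega>. \<forall>X. finite X \<and> int N \<le> int (card X) \<longrightarrow>
      (\<exists>t\<in>X. ereal (\<alpha> * real (card X))
        \<le> ereal_of_enat (cond_complexity U (encode_set_string X (restr \<omega> X)) (encode_nat_int t l)))"
      unfolding K_def by (intro exI[of _ "\<lambda>i. i \<in> A"]) auto
  qed
qed

end
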